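(* Let $\alpha\in(0,1)$ be fixed and let $K=K_{n,\theta,\alpha}$ be the length of a Pitman partition of $n$ with parameters $(\theta,\alpha)$, $\theta>0$. For every $r=1,2,\ldots$, under the asymptotic regime $n\to\infty$, $\theta\to\infty$, $\theta/n\to0$, $$ \mathsf{E}\left[\left(\frac{\alpha K}{\theta\left\{\left(\frac{n+\theta}{\theta}\right)^\alpha-1\right\}}\right)^r\right]=1+O\left(\frac{\theta^{2\alpha}}{n^{2\alpha}}+\frac{\theta}{n}+\frac{1}{\theta}\right). $$ In particular, for every $r=1,2,\ldots$, under the asymptotic regime $n\to\infty$, $\theta\to\infty$, $\theta/n\to0$, if moreover $$\frac{\theta^{2\alpha+1}}{n^{2\alpha}}\to0\quad\text{and}\quad\frac{\theta^2}{n}\to0,$$ then $$ \mathsf{E}\left[\left(\frac{\alpha K}{\theta\left\{\left(\frac{n+\theta}{\theta}\right)^\alpha-1\right\}}\right)^r\right]=1+r^2\frac{\alpha(1-\alpha)}{2\theta}+O\left(\frac{\theta^{2\alpha}}{n^{2\alpha}}+\frac{\theta}{n}+\frac{1}{\theta}\left(\frac{\theta^\alpha}{n^\alpha}+\frac{1}{\theta}\right)\right). $$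
   Context: For real $x$ and $y\ge 0$, put $(x)_{0;y}=1$ and $(x)_{i;y}=x(x+y)(x+2y)\cdots(x+(i-1)y)$ for $i=1,2,\ldots$; write $(x)_i=(x)_{i;1}$ (rising factorial). For a positive integer $n$, let $\mathcal{P}_n=\{(c_1,\ldots,c_n)\in(\mathbb{N}\cup\{0\})^n:\sum_{i=1}^n i c_i=n\}$ (component counts of integer partitions of $n$). For $\alpha\in(0,1)$ and $\theta>0$, a $\mathcal{P}_n$-valued random variable $\mathbf{C}=(C_1^{n,\theta,\alpha},\ldots,C_n^{n,\theta,\alpha})$ is the vector of component counts of a Pitman partition (follows the Pitman sampling formula) if $$\mathsf{P}(\mathbf{C}=(c_1,\ldots,c_n))=n!\,\frac{(\theta)_{k;\alpha}}{(\theta)_n}\prod_{i=1}^n\left(\frac{(1-\alpha)_{i-1}}{i!}\right)^{c_i}\frac{1}{c_i!},\qquad (c_1,\ldots,c_n)\in\mathcal{P}_n,\quad k=\sum_{i=1}^n c_i.$$ The length of the Pitman partition is $K=K_{n,\theta,\alpha}=\sum_{i=1}^n C_i^{n,\theta,\alpha}$. Asymptotic statements "under the regime $n\to\infty,\ \theta\to\infty,\ \theta/n\to0$" concern the parameters $n$ and $\theta>0$ varying simultaneously (along any sequence of pairs $(n,\theta)$ satisfying these limits), with $\alpha$ and $r$ fixed; $O(\cdot)$ is with respect to this limit, and its implied constant may depend on $r,\alpha$. *)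

theory Defs
  imports "HOL-Probability.Probability" "HOL-Library.Landau_Symbols" "HOL-Real_Asymp.Real_Asymp"
begin

definition rising_fact :: "real \<Rightarrow> real \<Rightarrow> nat \<Rightarrow> real" where
  "rising_fact x y i = (\<Prod>j<i. x + real j * y)"

lemma rising_fact_1: "rising_fact x 1 i = pochhammer x i"
  by (simp add: rising_fact_def pochhammer_prod atLeast0LessThan)

text \<open>
  A vector \<open>(c\<^sub>1, \<dots>, c\<^sub>n)\<close> is represented by a function on \<^typ>\<open>nat\<close> that vanishes outside
  \<open>{1..n}\<close>, so that distinct functions represent distinct vectors.
\<close>
definition component_counts :: "nat \<Rightarrow> (nat \<Rightarrow> nat) set" where
  "component_counts n = {c. (\<forall>i. i \<notin> {1..n} \<longrightarrow> c i = 0) \<and> (\<Sum>i=1..n. i * c i) = n}"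

definition partition_length :: "nat \<Rightarrow> (nat \<Rightarrow> nat) \<Rightarrow> nat" where
  "partition_length n c = (\<Sum>i=1..n. c i)"

definition pitman_sampling_formula :: "real \<Rightarrow> nat \<Rightarrow> real \<Rightarrow> (nat \<Rightarrow> nat) \<Rightarrow> real" where
  "pitman_sampling_formula \<alpha> n \<theta> c =
     fact n * (rising_fact \<theta> \<alpha> (partition_length n c) / pochhammer \<theta> n) *
     (\<Prod>i=1..n. (pochhammer (1 - \<alpha>) (i - 1) / fact i) ^ c i * (1 / fact (c i)))"

definition pitman_partition ::
    "real \<Rightarrow> nat \<Rightarrow> real \<Rightarrow> 'a measure \<Rightarrow> ('a \<Rightarrow> nat \<Rightarrow> nat) \<Rightarrow> bool" where
  "pitman_partition \<alpha> n \<theta> M C \<longleftrightarrow>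
     prob_space M \<and>
     C \<in> M \<rightarrow>\<^sub>M count_space (component_counts n) \<and>
     (\<forall>c\<in>component_counts n.
        measure M {\<omega> \<in> space M. C \<omega> = c} = pitman_sampling_formula \<alpha> n \<theta> c)"

text \<open>
  The regime \<open>n \<rightarrow> \<infinity>\<close>, \<open>\<theta> \<rightarrow> \<infinity>\<close>, \<open>\<theta>/n \<rightarrow> 0\<close> as a filter on pairs \<open>(n, \<theta>)\<close>, and its restriction
  by the two further limits; the lemmas \<open>filterlim_sparse_regime\<close> and
  \<open>filterlim_very_sparse_regime\<close> below say what it means for a sequence of pairs to
  follow these regimes.
\<close>
definition sparse_regime :: "(nat \<times> real) filter" where
  "sparse_regime =
     inf (at_top \<times>\<^sub>F at_top) (filtercomap (\<lambda>(n, \<theta>). \<theta> / real n) (nhds 0))"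

definition very_sparse_regime :: "real \<Rightarrow> (nat \<times> real) filter" where
  "very_sparse_regime \<alpha> =
     inf sparse_regime
       (inf (filtercomap (\<lambda>(n, \<theta>). \<theta> powr (2 * \<alpha> + 1) / real n powr (2 * \<alpha>)) (nhds 0))
            (filtercomap (\<lambda>(n, \<theta>). \<theta>\<^sup>2 / real n) (nhds 0)))"

lemma filterlim_prod_filter_iff:
  "filterlim (\<lambda>x. (f x, g x)) (F \<times>\<^sub>F G) H \<longleftrightarrow> filterlim f F H \<and> filterlim g G H"
proof
  assume *: "filterlim (\<lambda>x. (f x, g x)) (F \<times>\<^sub>F G) H"
  show "filterlim f F H \<and> filterlim g G H"
    using filterlim_compose[OF filterlim_fst *] filterlim_compose[OF filterlim_snd *] by simp
qed (auto intro: filterlim_Pair)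

lemma filterlim_sparse_regime:
  "filterlim (\<lambda>m. (N m, \<Theta> m)) sparse_regime F \<longleftrightarrow>
     filterlim N at_top F \<and> filterlim \<Theta> at_top F \<and> ((\<lambda>m. \<Theta> m / real (N m)) \<longlongrightarrow> 0) F"
  by (simp add: sparse_regime_def filterlim_inf filterlim_prod_filter_iff
      filterlim_filtercomap_iff o_def)

lemma filterlim_very_sparse_regime:
  "filterlim (\<lambda>m. (N m, \<Theta> m)) (very_sparse_regime \<alpha>) F \<longleftrightarrow>
     filterlim N at_top F \<and> filterlim \<Theta> at_top F \<and> ((\<lambda>m. \<Theta> m / real (N m)) \<longlongrightarrow> 0) F \<and>
     ((\<lambda>m. \<Theta> m powr (2 * \<alpha> + 1) / real (N m) powr (2 * \<alpha>)) \<longlongrightarrow> 0) F \<and>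
     ((\<lambda>m. (\<Theta> m)\<^sup>2 / real (N m)) \<longlongrightarrow> 0) F"
  by (simp add: very_sparse_regime_def filterlim_inf filterlim_sparse_regime
      filterlim_filtercomap_iff o_def)

lemma very_sparse_regime_neq_bot:
  assumes "\<alpha> > 0"
  shows "very_sparse_regime \<alpha> \<noteq> bot"
proof
  assume bot: "very_sparse_regime \<alpha> = bot"
  obtain k :: nat where k: "real k > 3 + 1 / (2 * \<alpha>)"
    using reals_Archimedean2 by blast
  have k': "2 * \<alpha> + 1 < 2 * \<alpha> * real k"
    using mult_strict_left_mono[OF k, of "2 * \<alpha>"] assms by (simp add: algebra_simps)
  have k3: "real k > 3"
    using k assms by (smt (verit) divide_nonneg_pos)
  have 1: "((\<lambda>m. real m / real m powr real k) \<longlongrightarrow> 0) sequentially"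
    using k3 by real_asymp
  have 2: "((\<lambda>m. real m powr (2 * \<alpha> + 1) / real m powr (2 * \<alpha> * real k)) \<longlongrightarrow> 0) sequentially"
    using k' by real_asymp
  have 3: "((\<lambda>m. (real m)\<^sup>2 / real m powr real k) \<longlongrightarrow> 0) sequentially"
    using k3 by real_asymp
  have eq: "real m powr real k = real (m ^ k)" if "m > 0" for m
    using that by (simp add: powr_realpow)
  have eq': "real m powr (2 * \<alpha> * real k) = real (m ^ k) powr (2 * \<alpha>)" if "m > 0" for m
    using eq[OF that] by (metis powr_powr mult.commute)
  have N: "filterlim (\<lambda>m. m ^ k) at_top (sequentially :: nat filter)"
  proof (rule filterlim_at_top_mono[OF filterlim_ident])
    show "\<forall>\<^sub>F m in sequentially. m \<le> m ^ k"
      using k3 by (intro eventually_mono[OF eventually_ge_at_top[of 1]] self_le_power) auto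
  qed
  have "filterlim (\<lambda>m. (m ^ k, real m)) (very_sparse_regime \<alpha>) sequentially"
    unfolding filterlim_very_sparse_regime
  proof (intro conjI N filterlim_real_sequentially)
    show "((\<lambda>m. real m / real (m ^ k)) \<longlongrightarrow> 0) sequentially"
      by (rule Lim_transform_eventually[OF 1 eventually_mono[OF eventually_gt_at_top[of 0]]])
         (simp add: eq)
    show "((\<lambda>m. real m powr (2 * \<alpha> + 1) / real (m ^ k) powr (2 * \<alpha>)) \<longlongrightarrow> 0) sequentially"
      by (rule Lim_transform_eventually[OF 2 eventually_mono[OF eventually_gt_at_top[of 0]]])
         (simp only: eq')
    show "((\<lambda>m. (real m)\<^sup>2 / real (m ^ k)) \<longlongrightarrow> 0) sequentially"
      by (rule Lim_transform_eventually[OF 3 eventually_mono[OF eventually_gt_at_top[of 0]]])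
         (simp add: eq)
  qed
  then have "filterlim (\<lambda>m. (m ^ k, real m)) bot (sequentially :: nat filter)"
    by (simp only: bot)
  then show False
    by (simp add: filterlim_def bot_unique filtermap_bot_iff)
qed

lemma sparse_regime_neq_bot: "sparse_regime \<noteq> bot"
  using very_sparse_regime_neq_bot[of 1] by (auto simp: very_sparse_regime_def)

definition normalized_length_moment ::
    "real \<Rightarrow> nat \<Rightarrow> real \<Rightarrow> 'a measure \<Rightarrow> ('a \<Rightarrow> nat \<Rightarrow> nat) \<Rightarrow> nat \<Rightarrow> real" where
  "normalized_length_moment \<alpha> n \<theta> M C r =
     prob_space.expectation M (\<lambda>\<omega>.
       (\<alpha> * real (partition_length n (C \<omega>)) / (\<theta> * (((real n + \<theta>) / \<theta>) powr \<alpha> - 1))) ^ r)"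

end

theory Submission
  imports Defs
begin

text \<open>
  Multiplying the sampling formula at \<open>\<theta>\<close> by \<open>(\<theta> + k\<alpha>)\<close> raised to a rising factorial of order \<open>r\<close> and
  step \<open>\<alpha>\<close> gives, up to a constant, the sampling formula at \<open>\<theta> + r\<alpha>\<close>. As both have total mass 1,
  \<open>Y = 1 + \<alpha> K / \<theta>\<close> has explicit rising moments, equal to a rising factorial times
  \<open>(\<theta> + r\<alpha>)\<^sub>n / (\<theta>)\<^sub>n\<close>. With \<open>x = ((n + \<theta>) / \<theta>)\<^sup>\<alpha>\<close>, a telescoping estimate of the logarithm of this
  quotient yields \<open>E Y\<^sup>r = x\<^sup>r (1 + r\<^sup>2 \<alpha> (1 - \<alpha>) / (2\<theta>) + O(\<delta>))\<close> with
  \<open>\<delta> = 1/\<theta>\<^sup>2 + 1/n + 1/(\<theta> x)\<close>. In the binomial expansion of \<open>(Y - 1)\<^sup>r\<close> replacing the coefficient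
  \<open>j\<^sup>2\<close> by \<open>r\<^sup>2\<close> in the terms with \<open>j < r\<close> costs only \<open>O(x\<^sup>r\<^sup>-\<^sup>1 / \<theta>)\<close>, so the main terms add up
  to \<open>(x - 1)\<^sup>r (1 + r\<^sup>2 \<alpha> (1 - \<alpha>) / (2\<theta>))\<close>.
\<close>

subsection \<open>Rising factorials\<close>

lemma rising_fact_Suc: "rising_fact x y (Suc r) = rising_fact x y r * (x + real r * y)"
  by (simp add: rising_fact_def)

lemma rising_fact_nonneg: "x \<ge> 0 \<Longrightarrow> y \<ge> 0 \<Longrightarrow> rising_fact x y r \<ge> 0"
  by (auto simp: rising_fact_def intro!: prod_nonneg)

lemma rising_fact_add:
  "rising_fact x y (k + r) = rising_fact x y k * rising_fact (x + real k * y) y r"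
  by (induction r) (auto simp: rising_fact_Suc rising_fact_def algebra_simps)

lemma rising_fact_scale: "rising_fact (c * x) (c * y) r = c ^ r * rising_fact x y r"
  by (induction r) (auto simp: rising_fact_Suc rising_fact_def algebra_simps)

lemma power_le_rising_fact: "y \<ge> 0 \<Longrightarrow> s \<ge> 0 \<Longrightarrow> y ^ r \<le> rising_fact y s r"
  unfolding rising_fact_def
  using prod_mono[of "{..<r}" "\<lambda>_. y" "\<lambda>j. y + real j * s"] by simp

text \<open>Moving from order \<open>r\<close> to \<open>r + 1\<close> multiplies the old gap by
  \<open>y\<close> and adds \<open>r * s\<close> times the rising factorial of order
  \<open>r\<close>; the crude constant \<open>r\<^sup>2\<close> survives because r^2 + r \<le> (r +
  1)^2. The gap thus has one degree less in \<open>y\<close>, which later becomes a factor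
  1/x.\<close>

lemma rising_fact_minus_power_le:
  assumes "y \<ge> 0" "s \<ge> 0"
  shows "rising_fact y s r - y ^ r \<le> (real r)\<^sup>2 * s * rising_fact y s (r - 1)"
proof (induction r)
  case (Suc r)
  have P: "rising_fact y s r \<ge> 0" using rising_fact_nonneg assms by blast
  \<comment> \<open>For \<open>r = 0\<close> the factor \<open>(real r)\<^sup>2\<close> vanishes,
    whatever the truncated \<open>r - 1\<close> is; otherwise the last factor of
    \<open>rising_fact y s r\<close> is at least \<open>y\<close>.\<close>
  have "y * (real r)\<^sup>2 * s * rising_fact y s (r - 1) \<le> (real r)\<^sup>2 * s * rising_fact y s r"
  proof (cases r)
    case (Suc m)
    have "y * rising_fact y s m \<le> rising_fact y s r"
      using assms rising_fact_nonneg[OF assms, of m] by (simp add: Suc rising_fact_Suc algebra_simps)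
    from mult_left_mono[OF this, of "(real r)\<^sup>2 * s"] show ?thesis
      using assms Suc by (simp add: mult_ac)
  qed simp
  moreover have "rising_fact y s (Suc r) - y ^ Suc r
      = y * (rising_fact y s r - y ^ r) + real r * s * rising_fact y s r"
    by (simp add: rising_fact_Suc algebra_simps)
  moreover have "y * (rising_fact y s r - y ^ r) \<le> y * ((real r)\<^sup>2 * s * rising_fact y s (r - 1))"
    using Suc.IH assms(1) by (rule mult_left_mono)
  moreover have "(real r)\<^sup>2 * s * rising_fact y s r + real r * s * rising_fact y s r
     \<le> (real (Suc r))\<^sup>2 * s * rising_fact y s r"
    using P assms mult_nonneg_nonneg[OF assms(2) P]
    by (simp add: power2_eq_square algebra_simps)
  ultimately show ?case by (simp add: mult_ac)
qed (simp add: rising_fact_def)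

text \<open>The coefficient of \<open>s\<close> is 0 + 1 + ... + (r - 1). Restricting to
  \<open>s \<le> 1\<close> makes the constant \<open>B\<close> uniform.\<close>

lemma rising_fact_one_expansion:
  shows "\<exists>B\<ge>0. \<forall>s. 0 \<le> s \<longrightarrow> s \<le> 1 \<longrightarrow>
    \<bar>rising_fact 1 s r - (1 + real r * (real r - 1) / 2 * s)\<bar> \<le> B * s\<^sup>2"
proof (induction r)
  case 0 show ?case by (intro exI[of _ 0]) (simp add: rising_fact_def)
next
  case (Suc r)
  then obtain B where B: "B \<ge> 0" "\<And>s. 0 \<le> s \<Longrightarrow> s \<le> 1 \<Longrightarrow>
    \<bar>rising_fact 1 s r - (1 + real r * (real r - 1) / 2 * s)\<bar> \<le> B * s\<^sup>2" by blast
  \<comment> \<open>\<open>b\<close> is the size of the only new quadratic term, the old linear term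
    times \<open>r * s\<close>.\<close>
  define b where "b = \<bar>real r * (real r - 1) / 2 * real r\<bar>"
  have "\<bar>rising_fact 1 s (Suc r) - (1 + real (Suc r) * (real (Suc r) - 1) / 2 * s)\<bar>
      \<le> (B * (1 + real r) + b) * s\<^sup>2" if s: "0 \<le> s" "s \<le> 1" for s
  proof -
    define e where "e = rising_fact 1 s r - (1 + real r * (real r - 1) / 2 * s)"
    have "rising_fact 1 s (Suc r) - (1 + real (Suc r) * (real (Suc r) - 1) / 2 * s)
      = e * (1 + real r * s) + (real r * (real r - 1) / 2 * real r) * s\<^sup>2"
      by (simp add: rising_fact_Suc e_def field_simps power2_eq_square)
    also have "\<bar>\<dots>\<bar> \<le> \<bar>e\<bar> * (1 + real r * s) + b * s\<^sup>2"
      using s by (intro order_trans[OF abs_triangle_ineq]) (simp add: abs_mult b_def)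
    also have "\<bar>e\<bar> * (1 + real r * s) \<le> (B * s\<^sup>2) * (1 + real r * 1)"
      using s B by (intro mult_mono add_mono mult_left_mono) (auto simp: e_def)
    finally show ?thesis by (simp add: algebra_simps)
  qed
  moreover have "B * (1 + real r) + b \<ge> 0" using B by (simp add: b_def)
  ultimately show ?case by blast
qed

subsection \<open>Quotients of Pochhammer symbols\<close>

text \<open>The lower bound is exp u \<ge> 1 + u. For negative u = -v, the upper bound follows from
  exp v \<ge> 1 + v and 1 / (1 + v) \<le> 1 - v + v^2.\<close>

lemma abs_exp_minus_one_minus_le_square:
  fixes u :: real assumes "\<bar>u\<bar> \<le> 1" shows "\<bar>exp u - 1 - u\<bar> \<le> u\<^sup>2"
proof -
  have "exp u \<le> 1 + u + u\<^sup>2"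
  proof (cases "u \<ge> 0")
    case True thus ?thesis using exp_bound[of u] assms by simp
  next
    case False
    define v where "v = - u"
    have v: "v > 0" using False by (simp add: v_def)
    have "exp u = 1 / exp v" by (simp add: v_def exp_minus field_simps)
    also have "\<dots> \<le> 1 / (1 + v)" using v exp_ge_add_one_self[of v] by (intro divide_left_mono) auto
    also have "\<dots> \<le> 1 - v + v\<^sup>2"
    proof -
      have "(1 - v + v\<^sup>2) * (1 + v) = 1 + v ^ 3" by (simp add: algebra_simps power2_eq_square power3_eq_cube)
      thus ?thesis using v by (simp add: divide_le_eq)
    qed
    finally show ?thesis by (simp add: v_def)
  qed
  with exp_ge_add_one_self[of u] show ?thesis by linarith
qed

text \<open>The combination is chosen so that the terms in 1/t and 1/t^2 cancel, the latter since
  -a^2/2 + a/2 + a(a - 1)/2 = 0. The remainder O(1/t^3) is phrased as a difference of inverse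
  squares, of the same order, so that it telescopes when summed over t, t + 1, ...\<close>

lemma log_step_expansion:
  fixes a :: real
  assumes "a \<ge> 0"
  shows "(\<lambda>t. ln (1 + a / t) - a * ln (1 + 1 / t) + a * (a - 1) / 2 * (1 / t - 1 / (t + 1)))
    \<in> O(\<lambda>t. 1 / t\<^sup>2 - 1 / (t + 1)\<^sup>2)"
proof -
  have ln_expansion: "(\<lambda>t::real. ln (1 + 1 / t) - 1 / t + 1 / (2 * t\<^sup>2)) \<in> O(\<lambda>t. 1 / t ^ 3)"
    by real_asymp
  have ln_expansion_scaled: "(\<lambda>t. ln (1 + a / t) - a / t + a\<^sup>2 / (2 * t\<^sup>2)) \<in> O(\<lambda>t. 1 / t ^ 3)"
  proof (cases "a = 0")
    case False
    with assms have a: "a > 0" by simp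
    \<comment> \<open>Substituting t/a for t turns the expansion of ln (1 + 1/t) into that of ln (1
      + a/t).\<close>
    hence "filterlim (\<lambda>t. t / a) at_top at_top" by real_asymp
    from landau_o.big.compose[OF ln_expansion this]
    have "(\<lambda>t. ln (1 + a / t) - a / t + a\<^sup>2 / (2 * t\<^sup>2)) \<in> O(\<lambda>t. a ^ 3 * (1 / t ^ 3))"
      by (simp add: power_divide)
    thus ?thesis using a by (subst (asm) landau_o.big.cmult) auto
  qed simp
  have inverse_expansion: "(\<lambda>t::real. 1 / t - 1 / (t + 1) - 1 / t\<^sup>2) \<in> O(\<lambda>t. 1 / t ^ 3)"
    by real_asymp
  have "(\<lambda>t. (ln (1 + a / t) - a / t + a\<^sup>2 / (2 * t\<^sup>2)) - a * (ln (1 + 1 / t) - 1 / t + 1 / (2 * t\<^sup>2))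
      + a * (a - 1) / 2 * (1 / t - 1 / (t + 1) - 1 / t\<^sup>2)) \<in> O(\<lambda>t. 1 / t ^ 3)"
    using ln_expansion inverse_expansion
    by (intro sum_in_bigo(1)[OF sum_in_bigo(2)[OF ln_expansion_scaled]]) simp_all
  also have "(\<lambda>t::real. 1 / t ^ 3) \<in> O(\<lambda>t. 1 / t\<^sup>2 - 1 / (t + 1)\<^sup>2)"
    by real_asymp
  finally have *: "(\<lambda>t. (ln (1 + a / t) - a / t + a\<^sup>2 / (2 * t\<^sup>2)) - a * (ln (1 + 1 / t) - 1 / t + 1 / (2 * t\<^sup>2))
      + a * (a - 1) / 2 * (1 / t - 1 / (t + 1) - 1 / t\<^sup>2)) \<in> O(\<lambda>t. 1 / t\<^sup>2 - 1 / (t + 1)\<^sup>2)" .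
  \<comment> \<open>With the logarithms and inverse powers as opaque atoms the cancellation is pure
    algebra.\<close>
  have cancel: "(L - a * p + a\<^sup>2 / 2 * q) - a * (L' - p + 1 / 2 * q) + a * (a - 1) / 2 * (p - p' - q)
      = L - a * L' + a * (a - 1) / 2 * (p - p')" for L L' p p' q :: real
    by (simp add: field_simps power2_eq_square)
  have eq: "(ln (1 + a / t) - a / t + a\<^sup>2 / (2 * t\<^sup>2)) - a * (ln (1 + 1 / t) - 1 / t + 1 / (2 * t\<^sup>2))
      + a * (a - 1) / 2 * (1 / t - 1 / (t + 1) - 1 / t\<^sup>2)
    = ln (1 + a / t) - a * ln (1 + 1 / t) + a * (a - 1) / 2 * (1 / t - 1 / (t + 1))" for t
    using cancel[of "ln (1 + a / t)" "1 / t" "1 / t\<^sup>2" "ln (1 + 1 / t)" "1 / (t + 1)"] by simp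
  show ?thesis using * by (simp only: eq)
qed

lemma ln_pochhammer_ratio:
  fixes a \<theta> :: real
  assumes "a \<ge> 0" "\<theta> > 0"
  shows "ln (pochhammer (\<theta> + a) n / pochhammer \<theta> n) = (\<Sum>j<n. ln (1 + a / (\<theta> + real j)))"
proof -
  have "pochhammer (\<theta> + a) n / pochhammer \<theta> n = (\<Prod>j<n. 1 + a / (\<theta> + real j))"
    unfolding pochhammer_prod atLeast0LessThan prod_dividef[symmetric]
    using assms by (intro prod.cong) (auto simp: field_simps add_pos_nonneg)
  moreover have "ln (\<Prod>j<n. 1 + a / (\<theta> + real j)) = (\<Sum>j<n. ln (1 + a / (\<theta> + real j)))"
    using assms by (intro ln_prod) (auto simp: add_nonneg_eq_0_iff)
  ultimately show ?thesis by simp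
qed

text \<open>Sum the one-step estimate over t = \<theta> + j for j < n. The logarithms of 1 + 1/t,
  the correction and the error bound all telescope, and the last sum is at most 1/\<theta>^2,
  uniformly in \<open>n\<close>.\<close>

lemma ln_pochhammer_ratio_expansion:
  fixes a :: real
  assumes "a \<ge> 0"
  shows "\<exists>T\<ge>1. \<exists>B\<ge>0. \<forall>\<theta>\<ge>T. \<forall>n.
    \<bar>ln (pochhammer (\<theta> + a) n / pochhammer \<theta> n) - a * ln ((real n + \<theta>) / \<theta>)
       + a * (a - 1) / 2 * (1 / \<theta> - 1 / (\<theta> + real n))\<bar> \<le> B / \<theta>\<^sup>2"
proof -
  define \<kappa> where "\<kappa> = a * (a - 1) / 2"
  define h where "h t = ln (1 + a / t) - a * ln (1 + 1 / t) + \<kappa> * (1 / t - 1 / (t + 1))" for t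
  obtain B where B: "B > 0"
    and ev: "eventually (\<lambda>t. \<bar>h t\<bar> \<le> B * \<bar>1 / t\<^sup>2 - 1 / (t + 1)\<^sup>2\<bar>) at_top"
    using log_step_expansion[OF assms] unfolding bigo_def \<kappa>_def h_def by auto
  then obtain T0 where T0: "\<And>t. t \<ge> T0 \<Longrightarrow> \<bar>h t\<bar> \<le> B * \<bar>1 / t\<^sup>2 - 1 / (t + 1)\<^sup>2\<bar>"
    unfolding eventually_at_top_linorder by blast
  show ?thesis
  \<comment> \<open>All points \<theta> + j lie above \<theta>, so one threshold on \<theta> serves
    every summand.\<close>
  proof (rule exI[of _ "max 1 T0"], rule conjI, simp, rule exI[of _ B], intro conjI allI impI)
    fix \<theta> :: real and n :: nat
    assume \<theta>: "\<theta> \<ge> max 1 T0"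
    define t where "t j = \<theta> + real j" for j
    have t: "t j \<ge> 1" "t j \<ge> T0" "t (Suc j) = t j + 1" for j using \<theta> by (auto simp: t_def)
    have tele: "(\<Sum>j<n. f (t (Suc j)) - f (t j)) = f (t n) - f \<theta>" for f :: "real \<Rightarrow> real"
      by (subst sum_lessThan_telescope) (simp add: t_def)
    have ln_step: "ln (1 + 1 / t j) = ln (t (Suc j)) - ln (t j)" for j
    proof -
      have "1 + 1 / t j = t (Suc j) / t j" using t(1)[of j] by (simp add: t(3) field_simps)
      thus ?thesis using t(1)[of j] t(1)[of "Suc j"] by (simp add: ln_div)
    qed
    have "(\<Sum>j<n. ln (1 + 1 / t j)) = ln ((real n + \<theta>) / \<theta>)"
      using tele[of ln] \<theta> by (simp only: ln_step) (simp add: t_def ln_div add_ac)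
    moreover have "(\<Sum>j<n. 1 / t j - 1 / (t j + 1)) = 1 / \<theta> - 1 / (\<theta> + real n)"
      using tele[of "\<lambda>t. - (1 / t)"] by (simp only: t(3)) (simp add: t_def)
    moreover have "ln (pochhammer (\<theta> + a) n / pochhammer \<theta> n) = (\<Sum>j<n. ln (1 + a / t j))"
      using ln_pochhammer_ratio[of a \<theta> n] assms \<theta> by (simp add: t_def)
    ultimately have "ln (pochhammer (\<theta> + a) n / pochhammer \<theta> n) - a * ln ((real n + \<theta>) / \<theta>)
         + \<kappa> * (1 / \<theta> - 1 / (\<theta> + real n)) = (\<Sum>j<n. h (t j))"
      by (simp only: h_def sum.distrib sum_subtractf sum_distrib_left[symmetric])
    moreover have "\<bar>\<Sum>j<n. h (t j)\<bar> \<le> B / \<theta>\<^sup>2"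
    proof -
      have h: "\<bar>h (t j)\<bar> \<le> B * (1 / (t j)\<^sup>2 - 1 / (t (Suc j))\<^sup>2)" for j
      proof -
        have "1 / (t j + 1)\<^sup>2 \<le> 1 / (t j)\<^sup>2"
          using t(1)[of j] by (intro frac_le power_mono) auto
        with T0[OF t(2)[of j]] show ?thesis by (simp add: t(3))
      qed
      have "\<bar>\<Sum>j<n. h (t j)\<bar> \<le> (\<Sum>j<n. B * (1 / (t j)\<^sup>2 - 1 / (t (Suc j))\<^sup>2))"
        by (rule order_trans[OF sum_abs]) (rule sum_mono, rule h)
      also have "\<dots> = B * (\<Sum>j<n. 1 / (t j)\<^sup>2 - 1 / (t (Suc j))\<^sup>2)"
        by (rule sum_distrib_left[symmetric])
      also have "(\<Sum>j<n. 1 / (t j)\<^sup>2 - 1 / (t (Suc j))\<^sup>2) = 1 / \<theta>\<^sup>2 - 1 / (t n)\<^sup>2"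
        using tele[of "\<lambda>t. - (1 / t\<^sup>2)"] by simp
      also have "B * (1 / \<theta>\<^sup>2 - 1 / (t n)\<^sup>2) \<le> B / \<theta>\<^sup>2"
        using B by (simp add: right_diff_distrib)
      finally show ?thesis .
    qed
    ultimately show "\<bar>ln (pochhammer (\<theta> + a) n / pochhammer \<theta> n) - a * ln ((real n + \<theta>) / \<theta>)
       + a * (a - 1) / 2 * (1 / \<theta> - 1 / (\<theta> + real n))\<bar> \<le> B / \<theta>\<^sup>2" by (simp only: \<kappa>_def)
  qed (use B in auto)
qed

subsection \<open>Moments of the Pitman partition\<close>

lemma finite_component_counts: "finite (component_counts n)"
proof (rule finite_subset)
  show "component_counts n \<subseteq> {c. \<forall>i. (i \<in> {1..n} \<longrightarrow> c i \<in> {..n}) \<and> (i \<notin> {1..n} \<longrightarrow> c i = 0)}"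
  proof (safe; (simp add: component_counts_def; fail)?)
    fix c i assume c: "c \<in> component_counts n" and i: "i \<in> {1..n}"
    have "1 * c i \<le> i * c i" using i by (intro mult_right_mono) auto
    also have "\<dots> \<le> (\<Sum>i=1..n. i * c i)" using i by (intro member_le_sum) auto
    finally show "c i \<le> n" using c by (simp add: component_counts_def)
  qed
  show "finite {c. \<forall>i. (i \<in> {1..n} \<longrightarrow> c i \<in> {..n}) \<and> (i \<notin> {1..n} \<longrightarrow> c i = (0::nat))}"
    by (rule finite_set_of_finite_funs) auto
qed

text \<open>As \<open>C\<close> has finite range, \<open>f (C \<omega>)\<close> is a finite
  combination of indicators of the events C = c, and only their probabilities enter.\<close>

lemma expectation_pitman_partition:
  fixes f :: "(nat \<Rightarrow> nat) \<Rightarrow> real"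
  assumes "pitman_partition \<alpha> n \<theta> M C"
  shows "prob_space.expectation M (\<lambda>\<omega>. f (C \<omega>))
    = (\<Sum>c\<in>component_counts n. pitman_sampling_formula \<alpha> n \<theta> c * f c)"
proof -
  interpret prob_space M using assms by (simp add: pitman_partition_def)
  have C: "C \<in> M \<rightarrow>\<^sub>M count_space (component_counts n)"
    and P: "\<And>c. c \<in> component_counts n \<Longrightarrow>
      prob {\<omega> \<in> space M. C \<omega> = c} = pitman_sampling_formula \<alpha> n \<theta> c"
    using assms by (auto simp: pitman_partition_def)
  have S: "{\<omega> \<in> space M. C \<omega> = c} \<in> events" if "c \<in> component_counts n" for c
    using measurable_sets[OF C, of "{c}"] that
    by (auto simp: vimage_def Int_def conj_commute)
  have "expectation (\<lambda>\<omega>. f (C \<omega>))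
     = expectation (\<lambda>\<omega>. \<Sum>c\<in>component_counts n. indicator {\<omega> \<in> space M. C \<omega> = c} \<omega> * f c)"
  proof (rule Bochner_Integration.integral_cong)
    fix \<omega> assume w: "\<omega> \<in> space M"
    hence "C \<omega> \<in> component_counts n" using measurable_space[OF C] by simp
    thus "f (C \<omega>) = (\<Sum>c\<in>component_counts n. indicator {\<omega> \<in> space M. C \<omega> = c} \<omega> * f c)"
      using w finite_component_counts[of n]
      by (subst sum.remove[of _ "C \<omega>"]) (auto simp: indicator_def intro!: sum.neutral)
  qed simp
  also have "\<dots> = (\<Sum>c\<in>component_counts n. prob {\<omega> \<in> space M. C \<omega> = c} * f c)"
    using S by (subst Bochner_Integration.integral_sum)
       (auto intro!: integrable_mult_left sum.cong simp: emeasure_eq_measure)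
  finally show ?thesis using P by simp
qed

text \<open>That the weights sum to 1 is read off from a random partition with this law, as the
  expectation of the constant 1, instead of from a combinatorial identity.\<close>

lemma pitman_sampling_formula_sum:
  assumes "pitman_partition \<alpha> n \<theta> M C"
  shows "(\<Sum>c\<in>component_counts n. pitman_sampling_formula \<alpha> n \<theta> c) = 1"
proof -
  interpret prob_space M using assms by (simp add: pitman_partition_def)
  show ?thesis
    using expectation_pitman_partition[OF assms, of "\<lambda>_. 1"] by (simp add: prob_space)
qed

text \<open>The expectation of f(K) as a finite sum, free of the probability space, which may differ
  for each pair of parameters.\<close>

definition pitman_mean :: "real \<Rightarrow> nat \<Rightarrow> real \<Rightarrow> (nat \<Rightarrow> real) \<Rightarrow> real" where
  "pitman_mean \<alpha> n \<theta> f =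
     (\<Sum>c\<in>component_counts n. pitman_sampling_formula \<alpha> n \<theta> c * f (partition_length n c))"

lemma pitman_mean_diff:
  "pitman_mean \<alpha> n \<theta> (\<lambda>k. f k - g k) = pitman_mean \<alpha> n \<theta> f - pitman_mean \<alpha> n \<theta> g"
  by (simp add: pitman_mean_def algebra_simps sum_subtractf)

lemma pitman_mean_cmult: "pitman_mean \<alpha> n \<theta> (\<lambda>k. a * f k) = a * pitman_mean \<alpha> n \<theta> f"
  by (simp add: pitman_mean_def sum_distrib_left mult_ac)

lemma pitman_mean_sum:
  "pitman_mean \<alpha> n \<theta> (\<lambda>k. \<Sum>i\<in>A. f i k) = (\<Sum>i\<in>A. pitman_mean \<alpha> n \<theta> (f i))"
  unfolding pitman_mean_def sum_distrib_left by (rule sum.swap)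

lemma pitman_sampling_formula_nonneg:
  assumes "0 < \<alpha>" "\<alpha> < 1" "\<theta> > 0"
  shows "pitman_sampling_formula \<alpha> n \<theta> c \<ge> 0"
  unfolding pitman_sampling_formula_def using assms
  by (intro mult_nonneg_nonneg divide_nonneg_nonneg prod_nonneg rising_fact_nonneg)
     (auto intro!: pochhammer_nonneg mult_nonneg_nonneg divide_nonneg_nonneg zero_le_power)

lemma pitman_mean_mono:
  assumes "0 < \<alpha>" "\<alpha> < 1" "\<theta> > 0" "\<And>k. f k \<le> g k"
  shows "pitman_mean \<alpha> n \<theta> f \<le> pitman_mean \<alpha> n \<theta> g"
  unfolding pitman_mean_def using assms
  by (intro sum_mono mult_left_mono pitman_sampling_formula_nonneg) auto

text \<open>Up to a constant and the scaling by \<open>\<theta> ^ r\<close>, the rising factorial is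
  the density of the law at \<theta> + r\<alpha> with respect to the law at \<theta>. The total mass
  assumed at \<theta> + r\<alpha> therefore evaluates the sum.\<close>

lemma pitman_mean_rising_fact:
  assumes "\<alpha> > 0" "\<theta> > 0"
    and "(\<Sum>c\<in>component_counts n. pitman_sampling_formula \<alpha> n (\<theta> + real r * \<alpha>) c) = 1"
  shows "pitman_mean \<alpha> n \<theta> (\<lambda>k. rising_fact (1 + \<alpha> * real k / \<theta>) (\<alpha> / \<theta>) r)
    = rising_fact 1 (\<alpha> / \<theta>) r * (pochhammer (\<theta> + real r * \<alpha>) n / pochhammer \<theta> n)"
proof -
  define p where "p = pochhammer (\<theta> + real r * \<alpha>) n / pochhammer \<theta> n"
  have poch: "pochhammer \<theta> n > 0" "pochhammer (\<theta> + real r * \<alpha>) n > 0"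
    using assms by (auto intro!: pochhammer_pos add_pos_nonneg)
  have scale: "\<theta> ^ r * rising_fact (1 + \<alpha> * real k / \<theta>) (\<alpha> / \<theta>) r = rising_fact (\<theta> + real k * \<alpha>) \<alpha> r" for k
    using assms by (subst rising_fact_scale[symmetric]) (simp add: distrib_left mult_ac)
  have "pitman_sampling_formula \<alpha> n \<theta> c * rising_fact (\<theta> + real k * \<alpha>) \<alpha> r
     = pitman_sampling_formula \<alpha> n (\<theta> + real r * \<alpha>) c * (rising_fact \<theta> \<alpha> r * p)"
    if k: "k = partition_length n c" for c k
  proof -
    \<comment> \<open>Both sides equal \<open>rising_fact \<theta> \<alpha> (k + r)\<close>, split
      after \<open>k\<close> or after \<open>r\<close> factors.\<close>
    have "rising_fact \<theta> \<alpha> k * rising_fact (\<theta> + real k * \<alpha>) \<alpha> r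
       = rising_fact \<theta> \<alpha> r * rising_fact (\<theta> + real r * \<alpha>) \<alpha> k"
      by (metis rising_fact_add add.commute)
    thus ?thesis
      using poch by (simp add: pitman_sampling_formula_def p_def k[symmetric] field_simps)
  qed
  hence "pitman_mean \<alpha> n \<theta> (\<lambda>k. rising_fact (\<theta> + real k * \<alpha>) \<alpha> r) = rising_fact \<theta> \<alpha> r * p"
    using assms(3) by (simp add: pitman_mean_def sum_distrib_right[symmetric])
  moreover have "rising_fact \<theta> \<alpha> r = \<theta> ^ r * rising_fact 1 (\<alpha> / \<theta>) r"
    using scale[of 0] by simp
  ultimately have "\<theta> ^ r * pitman_mean \<alpha> n \<theta> (\<lambda>k. rising_fact (1 + \<alpha> * real k / \<theta>) (\<alpha> / \<theta>) r)
      = \<theta> ^ r * (rising_fact 1 (\<alpha> / \<theta>) r * p)"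
    by (simp only: scale[symmetric] pitman_mean_cmult mult.assoc)
  hence "pitman_mean \<alpha> n \<theta> (\<lambda>k. rising_fact (1 + \<alpha> * real k / \<theta>) (\<alpha> / \<theta>) r)
      = rising_fact 1 (\<alpha> / \<theta>) r * p"
    using assms(2) by (subst (asm) mult_cancel_left) simp
  thus ?thesis by (simp only: p_def)
qed

text \<open>The normalized length is (Y - 1) / (x - 1) with Y = 1 + \<alpha>K/\<theta>; the
  numerator is expanded by the binomial theorem.\<close>

lemma normalized_length_moment_eq:
  assumes "pitman_partition \<alpha> n \<theta> M C" "\<theta> > 0"
  shows "normalized_length_moment \<alpha> n \<theta> M C r
    = (\<Sum>j\<le>r. real (r choose j) * (-1) ^ (r - j) * pitman_mean \<alpha> n \<theta> (\<lambda>k. (1 + \<alpha> * real k / \<theta>) ^ j))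
      / (((real n + \<theta>) / \<theta>) powr \<alpha> - 1) ^ r"
proof -
  define x where "x = ((real n + \<theta>) / \<theta>) powr \<alpha>"
  have "(\<alpha> * real k / (\<theta> * (x - 1))) ^ r
     = 1 / (x - 1) ^ r * (\<Sum>j\<le>r. real (r choose j) * (-1) ^ (r - j) * (1 + \<alpha> * real k / \<theta>) ^ j)" for k
  proof -
    have "(\<alpha> * real k / (\<theta> * (x - 1))) ^ r = 1 / (x - 1) ^ r * ((1 + \<alpha> * real k / \<theta>) + (-1)) ^ r"
      by (simp add: power_divide power_mult_distrib)
    thus ?thesis by (simp only: binomial_ring) (simp add: mult_ac)
  qed
  moreover have "normalized_length_moment \<alpha> n \<theta> M C r
      = pitman_mean \<alpha> n \<theta> (\<lambda>k. (\<alpha> * real k / (\<theta> * (x - 1))) ^ r)"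
    unfolding normalized_length_moment_def x_def[symmetric] pitman_mean_def
    by (rule expectation_pitman_partition[OF assms(1)])
  ultimately show ?thesis
    by (simp only: pitman_mean_cmult pitman_mean_sum x_def) simp
qed

subsection \<open>Asymptotic expansions\<close>

text \<open>An abstract filter with two parameter functions lets all asymptotics be stated for
  functions of a single variable \<open>z\<close>.\<close>

locale sparse_limit =
  fixes F :: "'b filter" and N :: "'b \<Rightarrow> nat" and \<Theta> :: "'b \<Rightarrow> real"
  assumes N_at_top: "filterlim N at_top F"
    and \<Theta>_at_top: "filterlim \<Theta> at_top F"
    and ratio_tendsto_0: "((\<lambda>z. \<Theta> z / real (N z)) \<longlongrightarrow> 0) F"
begin

text \<open>The first term collects second-order remainders in 1/\<theta>; the second pays for
  dropping the 1/(\<theta> + n) left by telescoping.\<close>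

abbreviation error :: "'b \<Rightarrow> real" where "error z \<equiv> 1 / (\<Theta> z)\<^sup>2 + 1 / real (N z)"

lemma eventually_\<Theta>_ge: "eventually (\<lambda>z. \<Theta> z \<ge> c) F"
  using \<Theta>_at_top by (simp add: filterlim_at_top)

lemma eventually_\<Theta>_le_N: "eventually (\<lambda>z. \<Theta> z \<le> real (N z)) F"
proof -
  have "eventually (\<lambda>z. \<Theta> z / real (N z) < 1) F"
    using order_tendstoD(2)[OF ratio_tendsto_0] by simp
  with eventually_\<Theta>_ge[of 1] show ?thesis
    using N_at_top[unfolded filterlim_at_top, rule_format, of 1]
    by eventually_elim (simp add: divide_less_eq)
qed

lemma inverse_\<Theta>_square_bigo: "(\<lambda>z. 1 / (\<Theta> z)\<^sup>2) \<in> O[F](error)"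
  by (intro bigoI[of _ 1] always_eventually) auto

lemma error_bigo_inverse_\<Theta>: "error \<in> O[F](\<lambda>z. 1 / \<Theta> z)"
proof (rule bigoI[of _ 2])
  show "eventually (\<lambda>z. norm (error z) \<le> 2 * norm (1 / \<Theta> z)) F"
    using eventually_\<Theta>_ge[of 1] eventually_\<Theta>_le_N
  proof eventually_elim
    case (elim z)
    have "1 / (\<Theta> z)\<^sup>2 \<le> 1 / \<Theta> z" using elim
      by (intro divide_left_mono) (auto simp: power2_eq_square)
    moreover have "1 / real (N z) \<le> 1 / \<Theta> z" using elim by (intro divide_left_mono) auto
    ultimately show ?case using elim by simp
  qed
qed

lemma inverse_\<Theta>_bigo_1: "(\<lambda>z. 1 / \<Theta> z) \<in> O[F](\<lambda>_. 1)"
proof (rule bigoI[of _ 1])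
  show "eventually (\<lambda>z. norm (1 / \<Theta> z) \<le> 1 * norm (1::real)) F"
    using eventually_\<Theta>_ge[of 1] by eventually_elim (simp add: divide_le_eq)
qed

lemma first_order_bigo_1: "(\<lambda>z. 1 + p / \<Theta> z) \<in> O[F](\<lambda>_. 1)"
proof -
  have "(\<lambda>z. p / \<Theta> z) \<in> O[F](\<lambda>_. 1)"
    using landau_o.big.mult[OF bigo_const[of p F] inverse_\<Theta>_bigo_1] by simp
  thus ?thesis by (intro sum_in_bigo) simp_all
qed

lemma bigo_1_of_expansion:
  assumes "(\<lambda>z. f z - (1 + p / \<Theta> z)) \<in> O[F](error)"
  shows "f \<in> O[F](\<lambda>_. 1)"
proof -
  have "(\<lambda>z. f z - (1 + p / \<Theta> z)) \<in> O[F](\<lambda>_. 1)"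
    using assms error_bigo_inverse_\<Theta> inverse_\<Theta>_bigo_1 by (meson landau_o.big_trans)
  hence "(\<lambda>z. f z - (1 + p / \<Theta> z) + (1 + p / \<Theta> z)) \<in> O[F](\<lambda>_. 1)"
    using first_order_bigo_1 by (rule sum_in_bigo)
  thus ?thesis by simp
qed

text \<open>First-order coefficients add: the cross term pq/\<theta>^2 is absorbed by
  \<open>error\<close>, and each remainder is multiplied by a bounded factor.\<close>

lemma expansion_mult:
  assumes "(\<lambda>z. f z - (1 + p / \<Theta> z)) \<in> O[F](error)" "(\<lambda>z. g z - (1 + q / \<Theta> z)) \<in> O[F](error)"
  shows "(\<lambda>z. f z * g z - (1 + (p + q) / \<Theta> z)) \<in> O[F](error)"
proof -
  have "(\<lambda>z. (f z - (1 + p / \<Theta> z)) * g z) \<in> O[F](error)"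
    using landau_o.big.mult[OF assms(1) bigo_1_of_expansion[OF assms(2)]] by simp
  moreover have "(\<lambda>z. (1 + p / \<Theta> z) * (g z - (1 + q / \<Theta> z))) \<in> O[F](error)"
    using landau_o.big.mult[OF first_order_bigo_1 assms(2)] by simp
  moreover have "(\<lambda>z. (p * q) * (1 / (\<Theta> z)\<^sup>2)) \<in> O[F](error)"
    using inverse_\<Theta>_square_bigo by (subst cmult_in_bigo_iff) simp
  ultimately have "(\<lambda>z. (f z - (1 + p / \<Theta> z)) * g z + (1 + p / \<Theta> z) * (g z - (1 + q / \<Theta> z))
      + (p * q) * (1 / (\<Theta> z)\<^sup>2)) \<in> O[F](error)"
    by (rule sum_in_bigo(1)[OF sum_in_bigo(1)])
  moreover have "(f z - (1 + p / \<Theta> z)) * g z + (1 + p / \<Theta> z) * (g z - (1 + q / \<Theta> z))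
      + (p * q) * (1 / (\<Theta> z)\<^sup>2) = f z * g z - (1 + (p + q) / \<Theta> z)" for z
    by (simp add: algebra_simps power2_eq_square add_divide_distrib)
  ultimately show ?thesis by (simp only:)
qed

text \<open>The quotient is exp u with u = -a(a - 1)/(2\<theta>) + O(\<open>error\<close>), by the
  logarithmic expansion. As u = O(1/\<theta>), replacing exp u by 1 + u costs only
  O(1/\<theta>^2).\<close>

lemma pochhammer_ratio_expansion:
  assumes a: "a \<ge> 0"
  shows "(\<lambda>z. pochhammer (\<Theta> z + a) (N z) / pochhammer (\<Theta> z) (N z)
      / ((real (N z) + \<Theta> z) / \<Theta> z) powr a - (1 + - (a * (a - 1) / 2) / \<Theta> z)) \<in> O[F](error)"
proof -
  define \<kappa> where "\<kappa> = a * (a - 1) / 2"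
  obtain T B where T: "T \<ge> 1" and B: "B \<ge> 0"
    and TB: "\<forall>\<theta>\<ge>T. \<forall>n. \<bar>ln (pochhammer (\<theta> + a) n / pochhammer \<theta> n) - a * ln ((real n + \<theta>) / \<theta>)
       + a * (a - 1) / 2 * (1 / \<theta> - 1 / (\<theta> + real n))\<bar> \<le> B / \<theta>\<^sup>2"
    using ln_pochhammer_ratio_expansion[OF a] by blast
  \<comment> \<open>\<open>D\<close> is made for the bound |u| \<le> D/\<theta>: one |\<kappa>|
    comes from the main term, one from |\<kappa>|/n \<le> |\<kappa>|/\<theta>, and \<open>B\<close>
    from B/\<theta>^2 \<le> B/\<theta>. Once \<theta> \<ge> D, the quadratic bound for exp
    applies.\<close>
  define D where "D = 2 * \<bar>\<kappa>\<bar> + B"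
  show ?thesis
  proof (rule bigoI)
    show "eventually (\<lambda>z. norm (pochhammer (\<Theta> z + a) (N z) / pochhammer (\<Theta> z) (N z)
      / ((real (N z) + \<Theta> z) / \<Theta> z) powr a - (1 + - (a * (a - 1) / 2) / \<Theta> z)) \<le>
        (D\<^sup>2 + B + \<bar>\<kappa>\<bar>) * norm (error z)) F"
      using eventually_\<Theta>_ge[of T] eventually_\<Theta>_ge[of "D"] eventually_\<Theta>_le_N
    proof eventually_elim
      case (elim z)
      define t n where "t = \<Theta> z" and "n = N z"
      have t: "t \<ge> 1" "t \<ge> D" "t \<ge> T" "t \<le> real n" using elim T by (auto simp: t_def n_def)
      define R where "R = pochhammer (t + a) n / pochhammer t n"
      have R: "R > 0" using t a by (auto simp: R_def intro!: divide_pos_pos pochhammer_pos)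
      define u where "u = ln R - a * ln ((real n + t) / t)"
      have ratio: "R / ((real n + t) / t) powr a = exp u"
        using R t by (simp add: u_def exp_diff powr_def)
      have u1: "\<bar>u + \<kappa> / t\<bar> \<le> \<bar>\<kappa>\<bar> / real n + B / t\<^sup>2"
      proof -
        have "u + \<kappa> / t = (u + \<kappa> * (1 / t - 1 / (t + real n))) + \<kappa> / (t + real n)"
          by (simp add: right_diff_distrib)
        also have "\<bar>\<dots>\<bar> \<le> \<bar>u + \<kappa> * (1 / t - 1 / (t + real n))\<bar> + \<bar>\<kappa> / (t + real n)\<bar>"
          by (rule abs_triangle_ineq)
        also have "\<bar>u + \<kappa> * (1 / t - 1 / (t + real n))\<bar> \<le> B / t\<^sup>2"
          using TB[rule_format, OF t(3), of n] by (simp only: u_def R_def \<kappa>_def)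
        also have "\<bar>\<kappa> / (t + real n)\<bar> \<le> \<bar>\<kappa>\<bar> / real n"
          using t by (auto intro!: divide_left_mono)
        finally show ?thesis by simp
      qed
      have u2: "\<bar>u\<bar> \<le> D / t"
      proof -
        have "\<bar>\<kappa>\<bar> / real n \<le> \<bar>\<kappa>\<bar> / t" using t by (intro divide_left_mono) auto
        moreover have "B / t\<^sup>2 \<le> B / t" using t B
          by (intro divide_left_mono) (auto simp: power2_eq_square)
        moreover have "\<bar>\<kappa> / t\<bar> = \<bar>\<kappa>\<bar> / t" using t by simp
        moreover have "D / t = \<bar>\<kappa>\<bar> / t + \<bar>\<kappa>\<bar> / t + B / t" by (simp add: D_def add_divide_distrib)
        ultimately show ?thesis using u1 by linarith
      qed
      have "D / t \<le> 1" using t by simp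
      hence "\<bar>exp u - 1 - u\<bar> \<le> u\<^sup>2"
        using u2 by (intro abs_exp_minus_one_minus_le_square) linarith
      also have "u\<^sup>2 \<le> (D / t)\<^sup>2" using u2 by (rule power2_le_iff_abs_le[THEN iffD2, rotated]) (use u2 in linarith)
      also have "\<dots> = D\<^sup>2 / t\<^sup>2" by (simp add: power_divide)
      finally have u3: "\<bar>exp u - 1 - u\<bar> \<le> D\<^sup>2 / t\<^sup>2" .
      have "\<bar>exp u - (1 + - \<kappa> / t)\<bar> \<le> D\<^sup>2 / t\<^sup>2 + \<bar>\<kappa>\<bar> / real n + B / t\<^sup>2"
        using u1 u3 by simp
      also have "\<dots> \<le> (D\<^sup>2 + B + \<bar>\<kappa>\<bar>) * (1 / t\<^sup>2 + 1 / real n)"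
        using B by (simp add: algebra_simps)
      finally show ?case
        unfolding t_def[symmetric] n_def[symmetric] R_def[symmetric] \<kappa>_def[symmetric]
        using ratio by (simp add: abs_of_nonneg)
    qed
  qed
qed

lemma rising_fact_expansion:
  assumes "\<alpha> > 0"
  shows "(\<lambda>z. rising_fact 1 (\<alpha> / \<Theta> z) r - (1 + (real r * (real r - 1) / 2 * \<alpha>) / \<Theta> z)) \<in> O[F](error)"
proof -
  obtain B where B: "B \<ge> 0" "\<forall>s. 0 \<le> s \<longrightarrow> s \<le> 1 \<longrightarrow>
    \<bar>rising_fact 1 s r - (1 + real r * (real r - 1) / 2 * s)\<bar> \<le> B * s\<^sup>2"
    using rising_fact_one_expansion[of r] by blast
  have "(\<lambda>z. rising_fact 1 (\<alpha> / \<Theta> z) r - (1 + (real r * (real r - 1) / 2 * \<alpha>) / \<Theta> z))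
     \<in> O[F](\<lambda>z. 1 / (\<Theta> z)\<^sup>2)"
  proof (rule bigoI[of _ "B * \<alpha>\<^sup>2"])
    show "eventually (\<lambda>z. norm (rising_fact 1 (\<alpha> / \<Theta> z) r - (1 + (real r * (real r - 1) / 2 * \<alpha>) / \<Theta> z))
       \<le> B * \<alpha>\<^sup>2 * norm (1 / (\<Theta> z)\<^sup>2)) F"
      using eventually_\<Theta>_ge[of "max 1 \<alpha>"]
    proof eventually_elim
      case (elim z)
      thus ?case using B(2)[rule_format, of "\<alpha> / \<Theta> z"] assms by (simp add: power_divide)
    qed
  qed
  thus ?thesis using inverse_\<Theta>_square_bigo by (rule landau_o.big_trans)
qed

end

section \<open>The growing scale x and the error \<delta>\<close>

context sparse_limit
begin

definition scale :: "real \<Rightarrow> 'b \<Rightarrow> real" where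
  "scale \<alpha> z = ((real (N z) + \<Theta> z) / \<Theta> z) powr \<alpha>"

text \<open>The last term is the relative cost of losing one power of x while gaining a factor
  1/\<theta>.\<close>

definition moment_error :: "real \<Rightarrow> 'b \<Rightarrow> real" where
  "moment_error \<alpha> z = error z + 1 / (\<Theta> z * scale \<alpha> z)"

lemma scale_at_top:
  assumes "\<alpha> > 0"
  shows "filterlim (scale \<alpha>) at_top F"
proof -
  have "filterlim (\<lambda>z. inverse (\<Theta> z / real (N z))) at_top F"
  proof (rule filterlim_inverse_at_top[OF ratio_tendsto_0])
    show "eventually (\<lambda>z. 0 < \<Theta> z / real (N z)) F"
      using eventually_\<Theta>_ge[of 1] eventually_\<Theta>_le_N by eventually_elim simp
  qed
  hence "filterlim (\<lambda>z. (real (N z) + \<Theta> z) / \<Theta> z) at_top F"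
  proof (rule filterlim_at_top_mono)
    show "eventually (\<lambda>z. inverse (\<Theta> z / real (N z)) \<le> (real (N z) + \<Theta> z) / \<Theta> z) F"
      using eventually_\<Theta>_ge[of 1] by eventually_elim (simp add: divide_right_mono)
  qed
  moreover have "filterlim (\<lambda>y::real. y powr \<alpha>) at_top at_top"
    using assms by real_asymp
  ultimately show ?thesis
    unfolding scale_def by (rule filterlim_compose[rotated])
qed

lemma eventually_scale_ge:
  assumes "\<alpha> > 0"
  shows "eventually (\<lambda>z. scale \<alpha> z \<ge> c) F"
  using scale_at_top[OF assms] by (simp add: filterlim_at_top)

lemma scale_power_bigo:
  assumes "\<alpha> > 0" "i \<le> j"
  shows "(\<lambda>z. scale \<alpha> z ^ i) \<in> O[F](\<lambda>z. scale \<alpha> z ^ j)"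
proof (rule bigoI[of _ 1])
  show "eventually (\<lambda>z. norm (scale \<alpha> z ^ i) \<le> 1 * norm (scale \<alpha> z ^ j)) F"
    using eventually_scale_ge[OF assms(1), of 1]
    by eventually_elim (simp add: power_increasing assms)
qed

lemma error_bigo_moment_error:
  assumes "\<alpha> > 0"
  shows "error \<in> O[F](moment_error \<alpha>)"
proof (rule bigoI[of _ 1])
  show "eventually (\<lambda>z. norm (error z) \<le> 1 * norm (moment_error \<alpha> z)) F"
    using eventually_scale_ge[OF assms(1), of 1] eventually_\<Theta>_ge[of 1]
    by eventually_elim (simp add: moment_error_def)
qed

lemma inverse_scale_bigo_moment_error:
  assumes "\<alpha> > 0"
  shows "(\<lambda>z. 1 / (\<Theta> z * scale \<alpha> z)) \<in> O[F](moment_error \<alpha>)"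
proof (rule bigoI[of _ 1])
  show "eventually (\<lambda>z. norm (1 / (\<Theta> z * scale \<alpha> z)) \<le> 1 * norm (moment_error \<alpha> z)) F"
    using eventually_scale_ge[OF assms(1), of 1] eventually_\<Theta>_ge[of 1]
    by eventually_elim (simp add: moment_error_def)
qed

end

section \<open>Rising, ordinary and centered moments along the regime\<close>

locale pitman_sparse_limit = sparse_limit F N \<Theta>
  for F :: "'b filter" and N :: "'b \<Rightarrow> nat" and \<Theta> :: "'b \<Rightarrow> real" +
  fixes \<alpha> :: real
  assumes \<alpha>: "0 < \<alpha>" "\<alpha> < 1"
    and normalized: "\<And>n \<theta>. n \<ge> 1 \<Longrightarrow> \<theta> > 0 \<Longrightarrow>
      (\<Sum>c\<in>component_counts n. pitman_sampling_formula \<alpha> n \<theta> c) = 1"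
begin

abbreviation "x \<equiv> scale \<alpha>"
abbreviation "\<delta> \<equiv> moment_error \<alpha>"

definition power_mean :: "nat \<Rightarrow> 'b \<Rightarrow> real" where
  "power_mean r z = pitman_mean \<alpha> (N z) (\<Theta> z) (\<lambda>k. (1 + \<alpha> * real k / \<Theta> z) ^ r)"

definition rising_mean :: "nat \<Rightarrow> 'b \<Rightarrow> real" where
  "rising_mean r z =
    pitman_mean \<alpha> (N z) (\<Theta> z) (\<lambda>k. rising_fact (1 + \<alpha> * real k / \<Theta> z) (\<alpha> / \<Theta> z) r)"

definition second_order :: "nat \<Rightarrow> real" where
  "second_order r = (real r)\<^sup>2 * (\<alpha> * (1 - \<alpha>) / 2)"

text \<open>The explicit rising moment is a product of two expanded factors, the Pochhammer quotient
  being taken at a = r\<alpha>. Total mass 1 enters at the shifted parameter \<theta> + r\<alpha>,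
  hence the form of the assumption \<open>normalized\<close>.\<close>

lemma rising_mean_expansion:
  "(\<lambda>z. rising_mean r z / x z ^ r - (1 + second_order r / \<Theta> z)) \<in> O[F](error)"
proof -
  have "(\<lambda>z. rising_fact 1 (\<alpha> / \<Theta> z) r * (pochhammer (\<Theta> z + real r * \<alpha>) (N z) / pochhammer (\<Theta> z) (N z)
      / ((real (N z) + \<Theta> z) / \<Theta> z) powr (real r * \<alpha>)) - (1 + (real r * (real r - 1) / 2 * \<alpha>
        + - (real r * \<alpha> * (real r * \<alpha> - 1) / 2)) / \<Theta> z)) \<in> O[F](error)"
    using \<alpha> by (intro expansion_mult rising_fact_expansion pochhammer_ratio_expansion) auto
  \<comment> \<open>The terms linear in \<open>r\<close> cancel, which leaves a pure multiple of
    r^2.\<close>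
  also have "real r * (real r - 1) / 2 * \<alpha> + - (real r * \<alpha> * (real r * \<alpha> - 1) / 2) = second_order r"
    by (simp add: second_order_def field_simps power2_eq_square)
  finally show ?thesis
  proof (rule landau_o.big.in_cong[THEN iffD1, rotated])
    show "eventually (\<lambda>z. rising_fact 1 (\<alpha> / \<Theta> z) r * (pochhammer (\<Theta> z + real r * \<alpha>) (N z) / pochhammer (\<Theta> z) (N z)
      / ((real (N z) + \<Theta> z) / \<Theta> z) powr (real r * \<alpha>)) - (1 + second_order r / \<Theta> z)
      = rising_mean r z / x z ^ r - (1 + second_order r / \<Theta> z)) F"
      using eventually_\<Theta>_ge[of 1] eventually_\<Theta>_le_N
    proof eventually_elim
      case (elim z)
      have "x z ^ r = ((real (N z) + \<Theta> z) / \<Theta> z) powr (real r * \<alpha>)"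
        using elim by (simp add: scale_def powr_power mult.commute)
      moreover have "\<Theta> z + real r * \<alpha> > 0" using elim \<alpha> by (intro add_pos_nonneg) auto
      ultimately show ?case
        using elim \<alpha> normalized[of "N z" "\<Theta> z + real r * \<alpha>"]
        by (simp add: rising_mean_def pitman_mean_rising_fact)
    qed
  qed
qed

text \<open>Rising powers exceed ordinary ones by at most r^2 \<alpha>/\<theta> times the rising
  power of order r - 1. Its mean is O(x^(r - 1)), so relative to x^r the change is O(1/(\<theta>
  x)), a part of \<delta>.\<close>

lemma power_mean_expansion:
  "(\<lambda>z. power_mean r z / x z ^ r - (1 + second_order r / \<Theta> z)) \<in> O[F](\<delta>)"
proof -
  have "(\<lambda>z. rising_mean r z / x z ^ r - power_mean r z / x z ^ r) \<in> O[F](\<lambda>z. 1 / (\<Theta> z * x z))"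
  proof (cases r)
    case 0 thus ?thesis by (simp add: rising_mean_def power_mean_def rising_fact_def)
  next
    case (Suc m)
    have "(\<lambda>z. rising_mean r z / x z ^ r - power_mean r z / x z ^ r)
        \<in> O[F](\<lambda>z. 1 / (\<Theta> z * x z) * (rising_mean m z / x z ^ m))"
    proof (rule bigoI[of _ "(real r)\<^sup>2 * \<alpha>"])
      show "eventually (\<lambda>z. norm (rising_mean r z / x z ^ r - power_mean r z / x z ^ r)
         \<le> (real r)\<^sup>2 * \<alpha> * norm (1 / (\<Theta> z * x z) * (rising_mean m z / x z ^ m))) F"
        using eventually_\<Theta>_ge[of 1] eventually_scale_ge[OF \<alpha>(1), of 1]
      proof eventually_elim
        case (elim z)
        have pos: "1 + \<alpha> * real k / \<Theta> z \<ge> 0" "\<alpha> / \<Theta> z \<ge> 0" for k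
          using elim \<alpha> by (auto intro!: add_nonneg_nonneg)
        have step: "rising_fact (1 + \<alpha> * real k / \<Theta> z) (\<alpha> / \<Theta> z) r - (1 + \<alpha> * real k / \<Theta> z) ^ r
            \<le> (real r)\<^sup>2 * (\<alpha> / \<Theta> z) * rising_fact (1 + \<alpha> * real k / \<Theta> z) (\<alpha> / \<Theta> z) m" for k
          using rising_fact_minus_power_le[OF pos(1)[of k] pos(2), of r] by (simp only: Suc diff_Suc_1)
        have "power_mean r z \<le> rising_mean r z"
          unfolding power_mean_def rising_mean_def using elim \<alpha> pos
          by (intro pitman_mean_mono power_le_rising_fact) auto
        moreover have "rising_mean r z - power_mean r z \<le> (real r)\<^sup>2 * (\<alpha> / \<Theta> z) * rising_mean m z"
          unfolding rising_mean_def power_mean_def pitman_mean_diff[symmetric] pitman_mean_cmult[symmetric]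
          by (intro pitman_mean_mono step) (use elim \<alpha> in auto)
        ultimately have "\<bar>rising_mean r z - power_mean r z\<bar> \<le> (real r)\<^sup>2 * (\<alpha> / \<Theta> z) * \<bar>rising_mean m z\<bar>"
          using \<alpha> elim by (smt (verit) mult_left_mono zero_le_power2 divide_nonneg_pos mult_nonneg_nonneg)
        hence "\<bar>rising_mean r z - power_mean r z\<bar> / x z ^ r
           \<le> (real r)\<^sup>2 * (\<alpha> / \<Theta> z) * \<bar>rising_mean m z\<bar> / x z ^ r"
          using elim by (intro divide_right_mono) auto
        thus ?case using elim
          by (simp add: diff_divide_distrib[symmetric] abs_mult Suc)
      qed
    qed
    also have "(\<lambda>z. 1 / (\<Theta> z * x z) * (rising_mean m z / x z ^ m)) \<in> O[F](\<lambda>z. 1 / (\<Theta> z * x z) * 1)"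
      by (intro landau_o.big.mult landau_o.big_refl bigo_1_of_expansion[OF rising_mean_expansion])
    finally show ?thesis by simp
  qed
  hence "(\<lambda>z. rising_mean r z / x z ^ r - power_mean r z / x z ^ r) \<in> O[F](\<delta>)"
    using inverse_scale_bigo_moment_error[OF \<alpha>(1)] by (rule landau_o.big_trans)
  moreover have "(\<lambda>z. rising_mean r z / x z ^ r - (1 + second_order r / \<Theta> z)) \<in> O[F](\<delta>)"
    using rising_mean_expansion error_bigo_moment_error[OF \<alpha>(1)] by (rule landau_o.big_trans)
  ultimately have "(\<lambda>z. (rising_mean r z / x z ^ r - (1 + second_order r / \<Theta> z))
     - (rising_mean r z / x z ^ r - power_mean r z / x z ^ r)) \<in> O[F](\<delta>)"
    by (rule sum_in_bigo(2)[rotated])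
  thus ?thesis by (simp add: algebra_simps)
qed

text \<open>The main term times (x - 1)^r is itself expanded binomially and subtracted termwise.
  Each summand is then O(x^r \<delta>), and (x - 1)^r is comparable to x^r.\<close>

lemma centered_mean_expansion:
  "(\<lambda>z. (\<Sum>j\<le>r. real (r choose j) * (-1) ^ (r - j) * power_mean j z) / (x z - 1) ^ r
     - (1 + second_order r / \<Theta> z)) \<in> O[F](\<delta>)"
proof -
  have summand: "(\<lambda>z. real (r choose j) * (-1) ^ (r - j) *
      (x z ^ j * (power_mean j z / x z ^ j - (1 + second_order j / \<Theta> z))
        + (second_order j - second_order r) * (x z ^ j * (1 / \<Theta> z)))) \<in> O[F](\<lambda>z. x z ^ r * \<delta> z)"
    if j: "j \<le> r" for j
  proof -
    have 1: "(\<lambda>z. x z ^ j * (power_mean j z / x z ^ j - (1 + second_order j / \<Theta> z)))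
        \<in> O[F](\<lambda>z. x z ^ r * \<delta> z)"
      using scale_power_bigo[OF \<alpha>(1) j] power_mean_expansion by (rule landau_o.big.mult)
    have 2: "(\<lambda>z. (second_order j - second_order r) * (x z ^ j * (1 / \<Theta> z))) \<in> O[F](\<lambda>z. x z ^ r * \<delta> z)"
    proof (cases "j = r")
      case False
      with j have "Suc j \<le> r" by simp
      \<comment> \<open>For j < r there is a power of x to spare: x^j/\<theta> = x^(j + 1) /
        (\<theta> x) with j + 1 \<le> r.\<close>
      have "(\<lambda>z. x z ^ j * (1 / \<Theta> z)) \<in> O[F](\<lambda>z. x z ^ Suc j * (1 / (\<Theta> z * x z)))"
      proof (rule bigoI[of _ 1])
        show "eventually (\<lambda>z. norm (x z ^ j * (1 / \<Theta> z)) \<le> 1 * norm (x z ^ Suc j * (1 / (\<Theta> z * x z)))) F"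
          using eventually_scale_ge[OF \<alpha>(1), of 1] by eventually_elim (simp add: abs_mult)
      qed
      also have "(\<lambda>z. x z ^ Suc j * (1 / (\<Theta> z * x z))) \<in> O[F](\<lambda>z. x z ^ r * \<delta> z)"
        using scale_power_bigo[OF \<alpha>(1) \<open>Suc j \<le> r\<close>] inverse_scale_bigo_moment_error[OF \<alpha>(1)]
        by (rule landau_o.big.mult)
      finally show ?thesis by (subst cmult_in_bigo_iff) (rule disjI2)
    qed simp
    show ?thesis using sum_in_bigo(1)[OF 1 2] by simp
  qed
  have "(\<lambda>z. \<Sum>j\<le>r. real (r choose j) * (-1) ^ (r - j) *
      (x z ^ j * (power_mean j z / x z ^ j - (1 + second_order j / \<Theta> z))
        + (second_order j - second_order r) * (x z ^ j * (1 / \<Theta> z)))) \<in> O[F](\<lambda>z. x z ^ r * \<delta> z)"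
    using summand by (intro big_sum_in_bigo) auto
  \<comment> \<open>Once x \<ge> 2, x \<le> 2(x - 1), whence the constant
    \<open>2 ^ r\<close>.\<close>
  moreover have "(\<lambda>z. 1 / (x z - 1) ^ r) \<in> O[F](\<lambda>z. 1 / x z ^ r)"
  proof (rule bigoI[of _ "2 ^ r"])
    show "eventually (\<lambda>z. norm (1 / (x z - 1) ^ r) \<le> 2 ^ r * norm (1 / x z ^ r)) F"
      using eventually_scale_ge[OF \<alpha>(1), of 2]
    proof eventually_elim
      case (elim z)
      have "x z ^ r \<le> (2 * (x z - 1)) ^ r" using elim by (intro power_mono) auto
      hence "x z ^ r \<le> 2 ^ r * (x z - 1) ^ r" by (simp only: power_mult_distrib)
      thus ?case using elim by (simp add: field_simps)
    qed
  qed
  ultimately have "(\<lambda>z. 1 / (x z - 1) ^ r * (\<Sum>j\<le>r. real (r choose j) * (-1) ^ (r - j) *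
      (x z ^ j * (power_mean j z / x z ^ j - (1 + second_order j / \<Theta> z))
        + (second_order j - second_order r) * (x z ^ j * (1 / \<Theta> z)))))
       \<in> O[F](\<lambda>z. 1 / x z ^ r * (x z ^ r * \<delta> z))"
    by (intro landau_o.big.mult)
  also have "(\<lambda>z. 1 / x z ^ r * (x z ^ r * \<delta> z)) \<in> O[F](\<delta>)"
    by (rule bigoI[of _ 1], rule eventually_mono[OF eventually_scale_ge[OF \<alpha>(1), of 1]]) simp
  finally show ?thesis
  proof (rule landau_o.big.in_cong[THEN iffD1, rotated])
    show "eventually (\<lambda>z. 1 / (x z - 1) ^ r * (\<Sum>j\<le>r. real (r choose j) * (-1) ^ (r - j) *
      (x z ^ j * (power_mean j z / x z ^ j - (1 + second_order j / \<Theta> z))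
        + (second_order j - second_order r) * (x z ^ j * (1 / \<Theta> z))))
      = (\<Sum>j\<le>r. real (r choose j) * (-1) ^ (r - j) * power_mean j z) / (x z - 1) ^ r
     - (1 + second_order r / \<Theta> z)) F"
      using eventually_scale_ge[OF \<alpha>(1), of 2]
    proof eventually_elim
      case (elim z)
      \<comment> \<open>The \<open>second_order j\<close> contributions cancel within each summand,
        so the remaining coefficient does not depend on \<open>j\<close> and can be pulled out of
        the sum.\<close>
      have "(\<Sum>j\<le>r. real (r choose j) * (-1) ^ (r - j) *
          (x z ^ j * (power_mean j z / x z ^ j - (1 + second_order j / \<Theta> z))
          + (second_order j - second_order r) * (x z ^ j * (1 / \<Theta> z))))
         = (\<Sum>j\<le>r. real (r choose j) * (-1) ^ (r - j) * power_mean j z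
             - (1 + second_order r / \<Theta> z) * (real (r choose j) * x z ^ j * (-1) ^ (r - j)))"
        using elim by (intro sum.cong refl) (simp add: algebra_simps diff_divide_distrib)
      also have "\<dots> = (\<Sum>j\<le>r. real (r choose j) * (-1) ^ (r - j) * power_mean j z)
             - (1 + second_order r / \<Theta> z) * (x z - 1) ^ r"
        using binomial_ring[of "x z" "-1" r] by (simp add: sum_subtractf sum_distrib_left[symmetric])
      finally show ?case using elim by (simp add: diff_divide_distrib)
    qed
  qed
qed

section \<open>Comparison of the error terms\<close>

lemma eventually_inverse_scale_le:
  "eventually (\<lambda>z. 1 / x z \<le> \<Theta> z powr \<alpha> / real (N z) powr \<alpha>) F"
  using eventually_\<Theta>_ge[of 1] eventually_\<Theta>_le_N
proof eventually_elim
  case (elim z)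
  have "1 / x z = (\<Theta> z / (real (N z) + \<Theta> z)) powr \<alpha>"
    using elim by (simp add: scale_def powr_divide)
  also have "\<dots> \<le> (\<Theta> z / real (N z)) powr \<alpha>"
    using elim \<alpha> by (intro powr_mono2 divide_left_mono) auto
  finally show ?case using elim by (simp add: powr_divide)
qed

text \<open>Termwise comparison: 1/n \<le> \<theta>/n once \<theta> \<ge> 1, and 1/x \<le>
  (\<theta>/n)^\<alpha>.\<close>

lemma moment_error_bigo:
  "\<delta> \<in> O[F](\<lambda>z. \<Theta> z powr (2 * \<alpha>) / real (N z) powr (2 * \<alpha>) + \<Theta> z / real (N z)
     + 1 / \<Theta> z * (\<Theta> z powr \<alpha> / real (N z) powr \<alpha> + 1 / \<Theta> z))"
proof (rule bigoI[of _ 1])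
  show "eventually (\<lambda>z. norm (\<delta> z) \<le> 1 * norm (\<Theta> z powr (2 * \<alpha>) / real (N z) powr (2 * \<alpha>) + \<Theta> z / real (N z)
     + 1 / \<Theta> z * (\<Theta> z powr \<alpha> / real (N z) powr \<alpha> + 1 / \<Theta> z))) F"
    using eventually_inverse_scale_le eventually_\<Theta>_ge[of 1] eventually_scale_ge[OF \<alpha>(1), of 1]
  proof eventually_elim
    case (elim z)
    have "1 / \<Theta> z * (1 / x z) \<le> 1 / \<Theta> z * (\<Theta> z powr \<alpha> / real (N z) powr \<alpha>)"
      using elim by (intro mult_left_mono) auto
    moreover have "1 / real (N z) \<le> \<Theta> z / real (N z)"
      using elim by (intro divide_right_mono) auto
    moreover have "\<Theta> z powr (2 * \<alpha>) / real (N z) powr (2 * \<alpha>) \<ge> 0" by simp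
    moreover have "1 / \<Theta> z * (1 / \<Theta> z) = 1 / (\<Theta> z)\<^sup>2" by (simp add: power2_eq_square)
    moreover have "\<delta> z \<ge> 0" using elim by (auto simp: moment_error_def intro!: add_nonneg_nonneg)
    moreover have "\<delta> z = 1 / (\<Theta> z)\<^sup>2 + 1 / real (N z) + 1 / \<Theta> z * (1 / x z)"
      by (simp add: moment_error_def)
    ultimately have "\<delta> z \<le> \<Theta> z powr (2 * \<alpha>) / real (N z) powr (2 * \<alpha>) + \<Theta> z / real (N z)
        + 1 / \<Theta> z * (\<Theta> z powr \<alpha> / real (N z) powr \<alpha> + 1 / \<Theta> z)"
      unfolding distrib_left by linarith
    with \<open>\<delta> z \<ge> 0\<close> show ?case by simp
  qed
qed

text \<open>For 1 \<le> \<theta> \<le> n the bracket multiplying 1/\<theta> is at most 2.\<close>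

lemma refined_error_bigo:
  "(\<lambda>z. \<Theta> z powr (2 * \<alpha>) / real (N z) powr (2 * \<alpha>) + \<Theta> z / real (N z)
     + 1 / \<Theta> z * (\<Theta> z powr \<alpha> / real (N z) powr \<alpha> + 1 / \<Theta> z))
   \<in> O[F](\<lambda>z. \<Theta> z powr (2 * \<alpha>) / real (N z) powr (2 * \<alpha>) + \<Theta> z / real (N z) + 1 / \<Theta> z)"
proof (rule bigoI[of _ 2])
  show "eventually (\<lambda>z. norm (\<Theta> z powr (2 * \<alpha>) / real (N z) powr (2 * \<alpha>) + \<Theta> z / real (N z)
     + 1 / \<Theta> z * (\<Theta> z powr \<alpha> / real (N z) powr \<alpha> + 1 / \<Theta> z))
     \<le> 2 * norm (\<Theta> z powr (2 * \<alpha>) / real (N z) powr (2 * \<alpha>) + \<Theta> z / real (N z) + 1 / \<Theta> z)) F"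
    using eventually_\<Theta>_ge[of 1] eventually_\<Theta>_le_N
  proof eventually_elim
    case (elim z)
    have "\<Theta> z powr \<alpha> / real (N z) powr \<alpha> \<le> 1"
      using elim \<alpha> by (simp add: powr_mono2)
    moreover have "1 / \<Theta> z \<le> 1" using elim by simp
    ultimately have "\<Theta> z powr \<alpha> / real (N z) powr \<alpha> + 1 / \<Theta> z \<le> 2" by linarith
    hence "1 / \<Theta> z * (\<Theta> z powr \<alpha> / real (N z) powr \<alpha> + 1 / \<Theta> z) \<le> 1 / \<Theta> z * 2"
      by (rule mult_left_mono) (use elim in simp)
    moreover have "1 / \<Theta> z * (\<Theta> z powr \<alpha> / real (N z) powr \<alpha> + 1 / \<Theta> z) \<ge> 0"
      using elim by (auto intro!: mult_nonneg_nonneg add_nonneg_nonneg)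
    moreover have "\<Theta> z powr (2 * \<alpha>) / real (N z) powr (2 * \<alpha>) \<ge> 0" "\<Theta> z / real (N z) \<ge> 0" "1 / \<Theta> z \<ge> 0"
      using elim by auto
    moreover have "\<bar>s + t + v\<bar> \<le> 2 * \<bar>s + t + u\<bar>"
      if "v \<le> u * 2" "0 \<le> v" "0 \<le> s" "0 \<le> t" "0 \<le> u" for s t u v :: real
      using that by simp
    ultimately show ?case unfolding real_norm_def by blast
  qed
qed

end

theorem theorem3p2:
  fixes \<alpha> :: real and r :: nat
    and M :: "nat \<Rightarrow> real \<Rightarrow> 'a measure"
    and C :: "nat \<Rightarrow> real \<Rightarrow> 'a \<Rightarrow> nat \<Rightarrow> nat"
  assumes "0 < \<alpha>" "\<alpha> < 1" "r \<ge> 1"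
    and "\<And>n \<theta>. n \<ge> 1 \<Longrightarrow> \<theta> > 0 \<Longrightarrow> pitman_partition \<alpha> n \<theta> (M n \<theta>) (C n \<theta>)"
  shows "(\<lambda>(n, \<theta>). normalized_length_moment \<alpha> n \<theta> (M n \<theta>) (C n \<theta>) r - 1)
           \<in> O[sparse_regime](\<lambda>(n, \<theta>).
               \<theta> powr (2 * \<alpha>) / real n powr (2 * \<alpha>) + \<theta> / real n + 1 / \<theta>)
       \<and> (\<lambda>(n, \<theta>). normalized_length_moment \<alpha> n \<theta> (M n \<theta>) (C n \<theta>) r
             - (1 + (real r)\<^sup>2 * (\<alpha> * (1 - \<alpha>) / (2 * \<theta>))))
           \<in> O[very_sparse_regime \<alpha>](\<lambda>(n, \<theta>).
               \<theta> powr (2 * \<alpha>) / real n powr (2 * \<alpha>) + \<theta> / real n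
               + 1 / \<theta> * (\<theta> powr \<alpha> / real n powr \<alpha> + 1 / \<theta>))"
proof -
  \<comment> \<open>The identity on pairs follows the regime, so the abstract results apply with
    \<open>fst\<close> and \<open>snd\<close> as parameter functions.\<close>
  have lim: "filterlim (\<lambda>z. (fst z, snd z)) sparse_regime sparse_regime"
    by (simp add: filterlim_ident)
  interpret pitman_sparse_limit sparse_regime fst snd \<alpha>
    using lim[unfolded filterlim_sparse_regime] assms(1,2)
      pitman_sampling_formula_sum[OF assms(4)] by unfold_locales auto
  define m where "m z = normalized_length_moment \<alpha> (fst z) (snd z) (M (fst z) (snd z)) (C (fst z) (snd z)) r" for z
  define e where "e z = snd z powr (2 * \<alpha>) / real (fst z) powr (2 * \<alpha>) + snd z / real (fst z)
    + 1 / snd z * (snd z powr \<alpha> / real (fst z) powr \<alpha> + 1 / snd z)" for z :: "nat \<times> real"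
  define e' where "e' z = snd z powr (2 * \<alpha>) / real (fst z) powr (2 * \<alpha>) + snd z / real (fst z)
    + 1 / snd z" for z :: "nat \<times> real"
  have "(\<lambda>z. m z - (1 + second_order r / snd z)) \<in> O[sparse_regime](\<delta>)"
    using centered_mean_expansion[of r]
  proof (rule landau_o.big.in_cong[THEN iffD1, rotated])
    show "eventually (\<lambda>z. (\<Sum>j\<le>r. real (r choose j) * (-1) ^ (r - j) * power_mean j z) / (x z - 1) ^ r
       - (1 + second_order r / snd z) = m z - (1 + second_order r / snd z)) sparse_regime"
      using eventually_\<Theta>_ge[of 1] eventually_\<Theta>_le_N
    proof eventually_elim
      case (elim z)
      hence "pitman_partition \<alpha> (fst z) (snd z) (M (fst z) (snd z)) (C (fst z) (snd z))"
        by (intro assms(4)) auto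
      from normalized_length_moment_eq[OF this, of r] elim show ?case
        by (simp add: m_def power_mean_def scale_def)
    qed
  qed
  also have "\<delta> \<in> O[sparse_regime](e)"
    using moment_error_bigo by (simp only: e_def[abs_def])
  finally have refined: "(\<lambda>z. m z - (1 + second_order r / snd z)) \<in> O[sparse_regime](e)" .
  also have "e \<in> O[sparse_regime](e')"
    using refined_error_bigo by (simp only: e_def[abs_def] e'_def[abs_def])
  finally have "(\<lambda>z. m z - (1 + second_order r / snd z)) \<in> O[sparse_regime](e')" .
  \<comment> \<open>In the coarse statement the first-order term disappears into the 1/\<theta> of
    the error.\<close>
  moreover have "(\<lambda>z. second_order r * (1 / snd z)) \<in> O[sparse_regime](e')"
  proof -
    have "(\<lambda>z. 1 / snd z) \<in> O[sparse_regime](e')"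
    proof (rule bigoI[of _ 1])
      show "eventually (\<lambda>z. norm (1 / snd z) \<le> 1 * norm (e' z)) sparse_regime"
        using eventually_\<Theta>_ge[of 1] by eventually_elim (simp add: e'_def)
    qed
    thus ?thesis by (subst cmult_in_bigo_iff) (rule disjI2)
  qed
  ultimately have "(\<lambda>z. m z - (1 + second_order r / snd z) + second_order r * (1 / snd z)) \<in> O[sparse_regime](e')"
    by (rule sum_in_bigo)
  hence coarse: "(\<lambda>z. m z - 1) \<in> O[sparse_regime](e')" by (simp add: algebra_simps)
  \<comment> \<open>The refined expansion passes to the finer filter by monotonicity.\<close>
  have "very_sparse_regime \<alpha> \<le> sparse_regime" by (simp add: very_sparse_regime_def)
  from landau_o.big.filter_mono[OF this refined]
  have "(\<lambda>z. m z - (1 + (real r)\<^sup>2 * (\<alpha> * (1 - \<alpha>) / (2 * snd z)))) \<in> O[very_sparse_regime \<alpha>](e)"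
    by (simp add: second_order_def field_simps)
  with coarse show ?thesis
    by (simp only: m_def e_def[abs_def] e'_def[abs_def] case_prod_beta')
qed

end
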